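(* Let $(U,R)$ be an approximation space, let $X\subseteq U$ be a rough set in $(U,R)$, and let $\mu:U\to[0,1]$ be a given membership function on $U$. If $\mu_{R_1},\mu_{R_2}:U\times U\to[0,1]$ are two FR relations on $X$ (with respect to $\mu$), then the composition $\mu_{R_1}\circ\mu_{R_2}$, defined by $(\mu_{R_1}\circ\mu_{R_2})(x,y)=\max_{u\in U}\min\{\mu_{R_1}(x,u),\mu_{R_2}(u,y)\}$ for all $x,y\in U$, is an FR relation on $X$ (with respect to $\mu$).
   Context: An approximation space $(U,R)$ is a set $U$ with an equivalence relation $R$ on $U$; $[x]_R$ is the $R$-class of $x$. Let $S$ be the equivalence relation on $U\times U$ given by $((x_1,y_1),(x_2,y_2))\in S$ iff $(x_1,x_2)\in R$ and $(y_1,y_2)\in R$; its classes are $[x,y]_S=[x]_R\times[y]_R$. A subset $X\subseteq U$ is a rough set if its lower approximation $\underline{X}=\{x\in U:[x]_R\subseteq X\}$ and its upper approximation $\overline{X}=\{x\in U:[x]_R\cap X\neq\emptyset\}$ are different. Put $\underline{X\times X}=\{(x,y)\in U\times U:[x,y]_S\subseteq X\times X\}$ and $\overline{X\times X}=\{(x,y)\in U\times U:[x,y]_S\cap (X\times X)\neq\emptyset\}$. Given a membership function $\mu:U\to[0,1]$ (a fuzzy set in $U$), a fuzzy rough relation (FR relation) on $X$ with respect to $\mu$ is a function $\mu_{R_1}:U\times U\to[0,1]$ such that $\mu_{R_1}(x,y)\le\min\{\mu(x),\mu(y)\}$ for all $(x,y)\in U\times U$ and (i) $\mu_{R_1}(x,y)=1$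 for all $(x,y)\in\underline{X\times X}$; (ii) $\mu_{R_1}(x,y)=0$ for all $(x,y)\in (U\times U)\setminus\overline{X\times X}$; (iii) $0<\mu_{R_1}(x,y)<1$ for all $(x,y)\in\overline{X\times X}\setminus\underline{X\times X}$. The composition is written with a maximum over $u\in U$; these maxima are understood to exist (automatic when $U$ is finite). *)

theory Defs
  imports Complex_Main "HOL-Library.FuncSet"
begin

text \<open>
  An approximation space is a carrier set \<open>U\<close> with \<open>equiv U R\<close>; the class of \<open>x\<close> is \<open>R `` {x}\<close>.
  Functions on \<open>U\<close> and on \<open>U \<times> U\<close> are total HOL functions of which only the values on the carrier
  matter.
\<close>

definition lower_approx :: "'a set \<Rightarrow> 'a rel \<Rightarrow> 'a set \<Rightarrow> 'a set" where
  "lower_approx U R X = {x \<in> U. R `` {x} \<subseteq> X}"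

definition upper_approx :: "'a set \<Rightarrow> 'a rel \<Rightarrow> 'a set \<Rightarrow> 'a set" where
  "upper_approx U R X = {x \<in> U. R `` {x} \<inter> X \<noteq> {}}"

definition rough_set :: "'a set \<Rightarrow> 'a rel \<Rightarrow> 'a set \<Rightarrow> bool" where
  "rough_set U R X \<longleftrightarrow> X \<subseteq> U \<and> lower_approx U R X \<noteq> upper_approx U R X"

definition square_rel :: "'a rel \<Rightarrow> ('a \<times> 'a) rel" where
  "square_rel R = {((x1, y1), (x2, y2)). (x1, x2) \<in> R \<and> (y1, y2) \<in> R}"

lemma square_rel_class: "square_rel R `` {(x, y)} = R `` {x} \<times> R `` {y}"
  by (auto simp: square_rel_def)

definition FR_relation ::
  "'a set \<Rightarrow> 'a rel \<Rightarrow> 'a set \<Rightarrow> ('a \<Rightarrow> real) \<Rightarrow> ('a \<times> 'a \<Rightarrow> real) \<Rightarrow> bool" where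
  "FR_relation U R X \<mu> \<rho> \<longleftrightarrow>
     (let L = lower_approx (U \<times> U) (square_rel R) (X \<times> X);
          H = upper_approx (U \<times> U) (square_rel R) (X \<times> X)
      in \<rho> \<in> U \<times> U \<rightarrow> {0..1} \<and>
         (\<forall>(x, y) \<in> U \<times> U. \<rho> (x, y) \<le> min (\<mu> x) (\<mu> y)) \<and>
         (\<forall>p \<in> L. \<rho> p = 1) \<and>
         (\<forall>p \<in> U \<times> U - H. \<rho> p = 0) \<and>
         (\<forall>p \<in> H - L. 0 < \<rho> p \<and> \<rho> p < 1))"

text \<open>
  The maximum is the greatest element of the set of values (not merely its supremum), so that \<open>U\<close>
  may be infinite; the value is unspecified where no greatest element exists.
\<close>

definition maxmin_comp ::
  "'a set \<Rightarrow> ('a \<times> 'a \<Rightarrow> real) \<Rightarrow> ('a \<times> 'a \<Rightarrow> real) \<Rightarrow> 'a \<times> 'a \<Rightarrow> real" where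
  "maxmin_comp U \<rho> \<sigma> =
     (\<lambda>(x, y). GREATEST m. m \<in> (\<lambda>u. min (\<rho> (x, u)) (\<sigma> (u, y))) ` U)"

end

theory Submission
  imports Defs
begin

text \<open>
  Since classes are nonempty, the approximations of \<open>X \<times> X\<close> are the squares of those of \<open>X\<close>.
  Hence the lower bounds on the composition come from the path through \<open>u = x\<close>, and the upper
  bounds from the fact that leaving a factor \<open>x\<close> or \<open>y\<close> outside one of the two approximations
  puts \<open>(x, u)\<close> or \<open>(u, y)\<close> outside its square for every \<open>u\<close>.
\<close>

text \<open>A nonempty product lies in \<open>X \<times> X\<close> exactly when both factors lie in
  \<open>X\<close>. Reflexivity of \<open>R\<close> rules out the degenerate case, in which an empty
  factor makes the inclusion hold whatever the other factor is.\<close>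

lemma lower_approx_square:
  fixes U :: "'a set"
  assumes "equiv U R"
  shows "lower_approx (U \<times> U) (square_rel R) (X \<times> X) = lower_approx U R X \<times> lower_approx U R X"
proof (rule set_eqI)
  fix p :: "'a \<times> 'a"
  obtain x y where p: "p = (x, y)"
    by (cases p)
  have "x \<in> U \<Longrightarrow> R `` {x} \<noteq> {}" "y \<in> U \<Longrightarrow> R `` {y} \<noteq> {}"
    using equiv_class_self[OF assms] by blast+
  then show "p \<in> lower_approx (U \<times> U) (square_rel R) (X \<times> X) \<longleftrightarrow>
      p \<in> lower_approx U R X \<times> lower_approx U R X"
    unfolding p lower_approx_def mem_Collect_eq mem_Times_iff fst_conv snd_conv
      square_rel_class times_subset_iff by blast
qed

lemma upper_approx_square:
  "upper_approx (U \<times> U) (square_rel R) (X \<times> X) = upper_approx U R X \<times> upper_approx U R X"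
  by (auto simp: upper_approx_def square_rel_def disjoint_iff)

lemma lower_approx_subset_upper_approx:
  assumes "equiv U R"
  shows "lower_approx U R X \<subseteq> upper_approx U R X"
  using equiv_class_self[OF assms]
  by (auto simp: lower_approx_def upper_approx_def)

text \<open>Recasts the three regional conditions as two level-set equivalences: the value 1 marks
  the square of the lower approximation, positivity that of the upper one. Both pass directly
  through \<open>min\<close> and a maximum.\<close>

lemma FR_relation_iff:
  assumes "equiv U R"
  shows "FR_relation U R X \<mu> \<rho> \<longleftrightarrow>
    (\<forall>x\<in>U. \<forall>y\<in>U. 0 \<le> \<rho> (x, y) \<and> \<rho> (x, y) \<le> 1 \<and> \<rho> (x, y) \<le> \<mu> x \<and> \<rho> (x, y) \<le> \<mu> y \<and>
      (\<rho> (x, y) = 1 \<longleftrightarrow> x \<in> lower_approx U R X \<and> y \<in> lower_approx U R X) \<and>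
      (0 < \<rho> (x, y) \<longleftrightarrow> x \<in> upper_approx U R X \<and> y \<in> upper_approx U R X))"
    (is "_ \<longleftrightarrow> ?rhs")
proof -
  let ?L = "lower_approx U R X" and ?H = "upper_approx U R X"
  have sub: "?L \<subseteq> ?H" "?H \<subseteq> U"
    using lower_approx_subset_upper_approx[OF assms] by (auto simp: upper_approx_def)
  have "FR_relation U R X \<mu> \<rho> \<longleftrightarrow>
      (\<forall>x\<in>U. \<forall>y\<in>U. 0 \<le> \<rho> (x, y) \<and> \<rho> (x, y) \<le> 1 \<and> \<rho> (x, y) \<le> \<mu> x \<and> \<rho> (x, y) \<le> \<mu> y \<and>
        (x \<in> ?L \<and> y \<in> ?L \<longrightarrow> \<rho> (x, y) = 1) \<and>
        (\<not> (x \<in> ?H \<and> y \<in> ?H) \<longrightarrow> \<rho> (x, y) = 0) \<and>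
        (x \<in> ?H \<and> y \<in> ?H \<and> \<not> (x \<in> ?L \<and> y \<in> ?L) \<longrightarrow> 0 < \<rho> (x, y) \<and> \<rho> (x, y) < 1))"
    (is "_ \<longleftrightarrow> ?mid")
  proof
    assume "FR_relation U R X \<mu> \<rho>"
    then show ?mid
      unfolding FR_relation_def Let_def lower_approx_square[OF assms] upper_approx_square
      by (auto simp: Pi_iff)
  next
    assume mid: ?mid
    \<comment> \<open>\<open>mid\<close> speaks only of points of \<open>U\<close>; for points given
      just by \<open>?L\<close> or \<open>?H\<close>, \<open>sub\<close> supplies membership in
      \<open>U\<close>.\<close>
    have "\<rho> (x, y) = 1" if "x \<in> ?L" "y \<in> ?L" for x y
      using mid[rule_format, of x y] that sub by blast
    moreover have "\<rho> (x, y) = 0" if "x \<in> U" "y \<in> U" "\<not> (x \<in> ?H \<and> y \<in> ?H)" for x y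
      using mid[rule_format, of x y] that by blast
    moreover have "0 < \<rho> (x, y) \<and> \<rho> (x, y) < 1"
      if "x \<in> ?H" "y \<in> ?H" "\<not> (x \<in> ?L \<and> y \<in> ?L)" for x y
      using mid[rule_format, of x y] that sub by blast
    ultimately show "FR_relation U R X \<mu> \<rho>"
      unfolding FR_relation_def Let_def lower_approx_square[OF assms] upper_approx_square
      using mid by (simp add: Pi_iff split_paired_all Ball_def)
  qed
  \<comment> \<open>The converse directions hold because the three regions exhaust
    \<open>U \<times> U\<close>: off the lower square the value is 0 or below 1, and off the upper
    square it is 0.\<close>
  also have "?mid \<longleftrightarrow> ?rhs"
  proof (intro ball_cong refl)
    fix x y
    have "x \<in> ?L \<longrightarrow> x \<in> ?H" "y \<in> ?L \<longrightarrow> y \<in> ?H"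
      using sub by auto
    then show "(0 \<le> \<rho> (x, y) \<and> \<rho> (x, y) \<le> 1 \<and> \<rho> (x, y) \<le> \<mu> x \<and> \<rho> (x, y) \<le> \<mu> y \<and>
        (x \<in> ?L \<and> y \<in> ?L \<longrightarrow> \<rho> (x, y) = 1) \<and>
        (\<not> (x \<in> ?H \<and> y \<in> ?H) \<longrightarrow> \<rho> (x, y) = 0) \<and>
        (x \<in> ?H \<and> y \<in> ?H \<and> \<not> (x \<in> ?L \<and> y \<in> ?L) \<longrightarrow> 0 < \<rho> (x, y) \<and> \<rho> (x, y) < 1)) \<longleftrightarrow>
      (0 \<le> \<rho> (x, y) \<and> \<rho> (x, y) \<le> 1 \<and> \<rho> (x, y) \<le> \<mu> x \<and> \<rho> (x, y) \<le> \<mu> y \<and>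
        (\<rho> (x, y) = 1 \<longleftrightarrow> x \<in> ?L \<and> y \<in> ?L) \<and>
        (0 < \<rho> (x, y) \<longleftrightarrow> x \<in> ?H \<and> y \<in> ?H))"
      by (smt (verit))
  qed
  finally show ?thesis .
qed

text \<open>Replaces \<open>GREATEST\<close> by a maximizing \<open>u\<close> and an upper-bound
  property, the two facts through which the composition is handled below.\<close>

lemma maxmin_comp_attained:
  assumes "\<exists>u\<in>U. \<forall>v\<in>U. min (\<rho> (x, v)) (\<sigma> (v, y)) \<le> min (\<rho> (x, u)) (\<sigma> (u, y))"
  obtains u where "u \<in> U" "maxmin_comp U \<rho> \<sigma> (x, y) = min (\<rho> (x, u)) (\<sigma> (u, y))"
    "\<And>v. v \<in> U \<Longrightarrow> min (\<rho> (x, v)) (\<sigma> (v, y)) \<le> maxmin_comp U \<rho> \<sigma> (x, y)"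
proof -
  obtain u where u: "u \<in> U"
    "\<And>v. v \<in> U \<Longrightarrow> min (\<rho> (x, v)) (\<sigma> (v, y)) \<le> min (\<rho> (x, u)) (\<sigma> (u, y))"
    using assms by blast
  have "maxmin_comp U \<rho> \<sigma> (x, y) = min (\<rho> (x, u)) (\<sigma> (u, y))"
    unfolding maxmin_comp_def prod.case by (rule Greatest_equality) (use u in auto)
  with u show thesis
    by (intro that[of u]) simp_all
qed

theorem proposition4p2:
  fixes U X :: "'a set" and R :: "'a rel"
    and \<mu> :: "'a \<Rightarrow> real" and \<mu>1 \<mu>2 :: "'a \<times> 'a \<Rightarrow> real"
  assumes "equiv U R"
    and "rough_set U R X"
    and "\<mu> \<in> U \<rightarrow> {0..1}"
    and "FR_relation U R X \<mu> \<mu>1"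
    and "FR_relation U R X \<mu> \<mu>2"
    and maxima_exist: "\<And>x y. x \<in> U \<Longrightarrow> y \<in> U \<Longrightarrow>
      \<exists>u\<in>U. \<forall>v\<in>U. min (\<mu>1 (x, v)) (\<mu>2 (v, y)) \<le> min (\<mu>1 (x, u)) (\<mu>2 (u, y))"
  shows "FR_relation U R X \<mu> (maxmin_comp U \<mu>1 \<mu>2)"
  unfolding FR_relation_iff[OF assms(1)]
proof (intro ballI)
  fix x y assume xy: "x \<in> U" "y \<in> U"
  note FR1 = assms(4)[unfolded FR_relation_iff[OF assms(1)], rule_format]
  note FR2 = assms(5)[unfolded FR_relation_iff[OF assms(1)], rule_format]
  let ?c = "maxmin_comp U \<mu>1 \<mu>2 (x, y)"
  obtain u where u: "u \<in> U" "?c = min (\<mu>1 (x, u)) (\<mu>2 (u, y))"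
    and ub: "\<And>v. v \<in> U \<Longrightarrow> min (\<mu>1 (x, v)) (\<mu>2 (v, y)) \<le> ?c"
    using maxmin_comp_attained[OF maxima_exist[OF xy]] by blast
  show "0 \<le> ?c \<and> ?c \<le> 1 \<and> ?c \<le> \<mu> x \<and> ?c \<le> \<mu> y \<and>
      (?c = 1 \<longleftrightarrow> x \<in> lower_approx U R X \<and> y \<in> lower_approx U R X) \<and>
      (0 < ?c \<longleftrightarrow> x \<in> upper_approx U R X \<and> y \<in> upper_approx U R X)"
    \<comment> \<open>The maximizer \<open>u\<close> serves the bounds from above: \<open>?c\<close>
      is at most \<open>\<mu>1 (x, u)\<close> and \<open>\<mu>2 (u, y)\<close>, so
      \<open>?c = 1\<close> or \<open>0 < ?c\<close> passes to both and places \<open>x\<close> and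
      \<open>y\<close>. The path through \<open>x\<close> serves the converses:
      \<open>\<mu>1 (x, x)\<close> and \<open>\<mu>2 (x, y)\<close> are both 1, or both positive,
      and \<open>ub\<close> carries this to \<open>?c\<close>.\<close>
    using FR1[OF xy(1) u(1)] FR2[OF u(1) xy(2)] FR1[OF xy(1) xy(1)] FR2[OF xy] u(2) ub[OF xy(1)]
    by (smt (verit))
qed

end
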